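(* Let $c\geq 2$, $n\ge 1$, and let $e_1,\dots,e_n$ be positive integers. Then $\mathit{r}(I_{c}^{e_{1}}D_{c}^{e_{2}}I_{c}^{e_{3}}\ldots \mathcal{L}_{c}^{e_{n}})= 2 \sum_{i=1}^{n}e_{i}-n$, where $\mathcal{L}$ is $I$ if $n$ is odd and $D$ if $n$ is even.
   Context: A sequence $s$ contains a sequence $u$ if some subsequence of $s$ can be changed into $u$ by a one-to-one renaming of its letters. $I_c$ denotes the sequence $1\,2\ldots c$ and $D_c$ the sequence $c\,(c-1)\ldots 1$; powers denote repeated concatenation. $\mathit{alt}(c,k)$ is the concatenation of $k$ blocks starting with $I_c$ and alternating between $I_c$ and $D_c$ (e.g. $\mathit{alt}(3,3)=123321123$). For a sequence $u$ with $c$ distinct letters, $\mathit{r}(u)$ is the smallest $k$ such that $\mathit{alt}(c,k)$ contains $u$. *)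

theory Defs
  imports Complex_Main "HOL-Library.Sublist"
begin

(* A renaming only has to be one-to-one on the letters occurring in the chosen subsequence. *)
definition contains :: "'a list \<Rightarrow> 'b list \<Rightarrow> bool" where
  "contains s u \<longleftrightarrow> (\<exists>t f. subseq t s \<and> inj_on f (set t) \<and> map f t = u)"

definition seq_I :: "nat \<Rightarrow> nat list" where
  "seq_I c = [1..<Suc c]"

definition seq_D :: "nat \<Rightarrow> nat list" where
  "seq_D c = rev (seq_I c)"

definition seq_power :: "'a list \<Rightarrow> nat \<Rightarrow> 'a list" where
  "seq_power s e = concat (replicate e s)"

(* Block number i, counting from 1: increasing in odd positions, decreasing in even ones. *)
definition block :: "nat \<Rightarrow> nat \<Rightarrow> nat list" where
  "block c i = (if odd i then seq_I c else seq_D c)"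

definition alt :: "nat \<Rightarrow> nat \<Rightarrow> nat list" where
  "alt c k = concat (map (block c) [1..<Suc k])"

lemma alt_3_3: "alt 3 3 = [1, 2, 3, 3, 2, 1, 1, 2, 3]"
  by (simp add: alt_def block_def seq_I_def seq_D_def upt_rec)

definition r :: "'a list \<Rightarrow> nat" where
  "r u = (LEAST k. contains (alt (card (set u)) k) u)"

(* alt_power c e n is I_c^(e 1) D_c^(e 2) I_c^(e 3) ... with n factors. *)
definition alt_power :: "nat \<Rightarrow> (nat \<Rightarrow> nat) \<Rightarrow> nat \<Rightarrow> nat list" where
  "alt_power c e n = concat (map (\<lambda>i. seq_power (block c i) (e i)) [1..<Suc n])"

end

theory Submission
  imports Defs
begin

text \<open>Restricting a sequence to two of its letters turns every block \<open>I\<^sub>c\<close> or \<open>D\<^sub>c\<close> into a two-letter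
  word, and the number of runs (maximal constant factors) is monotone under taking subsequences and
  invariant under renaming. Restricted to two letters, \<open>alt(c,k)\<close> has \<open>k + 1\<close> runs, while the given
  sequence has \<open>2(e\<^sub>1 + \<dots> + e\<^sub>n) - n + 1\<close> runs; this is the lower bound. It is attained because
  \<open>alt\<close> restricted to \<open>2e - 1\<close> consecutive blocks contains the \<open>e\<close>-th power of its first block.\<close>

section \<open>Runs under subsequences and renamings\<close>

lemma length_remdups_adj_Cons_le: "length (remdups_adj xs) \<le> length (remdups_adj (x # xs))"
  by (cases xs) auto

lemma length_remdups_adj_Cons_Cons:
  "length (remdups_adj (x # y # ys)) = (if x = y then 0 else 1) + length (remdups_adj (y # ys))"
  by simp

lemma length_remdups_adj_Cons_le_Suc: "length (remdups_adj (x # xs)) \<le> Suc (length (remdups_adj xs))"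
  by (cases xs) auto

text \<open>The common first letter \<open>x\<close> carries the induction: it records the letter
  before the current position, which decides whether the next letter opens a run.\<close>

lemma subseq_length_remdups_adj_Cons_le:
  "subseq xs ys \<Longrightarrow> length (remdups_adj (x # xs)) \<le> length (remdups_adj (x # ys))"
proof (induction arbitrary: x rule: list_emb.induct)
  case (list_emb_Nil ys)
  then show ?case using length_remdups_adj_Cons_le [of ys x]
    by (simp add: Suc_le_eq)
next
  case (list_emb_Cons xs ys y)
  \<comment> \<open>If \<open>x = y\<close> the counts agree. Otherwise \<open>y\<close> follows a
    completed run \<open>x\<close>, and deleting \<open>x\<close> from the front of
    \<open>x # xs\<close> loses at most one run.\<close>
  have "length (remdups_adj (x # xs)) \<le> length (remdups_adj (x # y # xs))"
    using length_remdups_adj_Cons_le_Suc [of x xs] length_remdups_adj_Cons_le [of xs y]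
    by (simp only: length_remdups_adj_Cons_Cons) auto
  then show ?case using list_emb_Cons.IH [of y]
    by (simp only: length_remdups_adj_Cons_Cons)
next
  case (list_emb_Cons2 x' y xs ys)
  then show ?case using list_emb_Cons2.IH [of y]
    by (auto simp only: length_remdups_adj_Cons_Cons add_le_cancel_left)
qed

lemma remdups_adj_map_inj_on:
  assumes "inj_on f (set xs)"
  shows "remdups_adj (map f xs) = map f (remdups_adj xs)"
  using assms by (induction xs rule: remdups_adj.induct) auto

lemma subseq_length_remdups_adj_le:
  assumes "subseq xs ys"
  shows "length (remdups_adj xs) \<le> length (remdups_adj ys)"
  using assms
proof (induction rule: list_emb.induct)
  case (list_emb_Cons xs ys y)
  then show ?case using length_remdups_adj_Cons_le [of ys y] by linarith
next
  case (list_emb_Cons2 x y xs ys)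
  then show ?case using subseq_length_remdups_adj_Cons_le [of xs ys y] by simp
qed simp

lemma length_remdups_adj_append_pair:
  assumes "xs \<noteq> []" "x \<noteq> y"
  shows "length (remdups_adj (xs @ [x, y])) =
    length (remdups_adj xs) + (if last xs = x then 1 else 2)"
proof -
  obtain zs where zs: "xs = zs @ [last xs]"
    using assms(1) by (metis append_butlast_last_id)
  have "remdups_adj (xs @ [x, y]) = remdups_adj xs @ tl (remdups_adj [last xs, x, y])"
    using remdups_adj_append [of zs "last xs" "[x, y]"] zs by (metis append.assoc append_Cons append_Nil)
  then show ?thesis using assms(2) by simp
qed

section \<open>Run counts after restriction to two letters\<close>

lemma alt_Suc: "alt c (Suc k) = alt c k @ block c (Suc k)"
  by (simp add: alt_def)

lemma alt_power_Suc: "alt_power c e (Suc n) = alt_power c e n @ seq_power (block c (Suc n)) (e (Suc n))"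
  by (simp add: alt_power_def)

lemma seq_power_Suc: "seq_power s (Suc e) = seq_power s e @ s"
  by (induction e) (simp_all add: seq_power_def)

lemma filter_two_upt:
  assumes "a < b" "a \<in> set [m..<n]" "b \<in> set [m..<n]"
  shows "filter (\<lambda>x. x \<in> {a, b}) [m..<n] = [a, b]"
proof (rule sorted_distinct_set_unique)
  show "sorted (filter (\<lambda>x. x \<in> {a, b}) [m..<n])" by (intro sorted_wrt_filter) simp
qed (use assms in auto)

lemma filter_two_block:
  assumes "a < b" "a \<in> {1..c}" "b \<in> {1..c}"
  shows "filter (\<lambda>x. x \<in> {a, b}) (block c i) = (if odd i then [a, b] else [b, a])"
  using filter_two_upt [of a b 1 "Suc c"] assms
  by (simp add: block_def seq_D_def seq_I_def rev_filter [symmetric] del: upt_Suc)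

lemma set_block: "set (block c i) = {1..c}"
  by (auto simp: block_def seq_D_def seq_I_def)

lemma filter_seq_power: "filter P (seq_power s e) = seq_power (filter P s) e"
  by (simp add: seq_power_def filter_concat)

text \<open>The first \<open>x\<close> continues the last run of \<open>xs\<close>, so the first
  copy adds one run; each later copy follows a \<open>y\<close> and adds two.\<close>

lemma runs_append_power:
  assumes "xs \<noteq> []" "last xs = x" "x \<noteq> y"
  shows "length (remdups_adj (xs @ seq_power [x, y] (Suc m))) = length (remdups_adj xs) + (2 * m + 1)
    \<and> last (xs @ seq_power [x, y] (Suc m)) = y"
proof (induction m)
  case 0
  then show ?case using assms by (simp add: seq_power_def length_remdups_adj_append_pair)
next
  case (Suc m)
  let ?zs = "xs @ seq_power [x, y] (Suc m)"
  have "xs @ seq_power [x, y] (Suc (Suc m)) = ?zs @ [x, y]"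
    by (simp add: seq_power_Suc)
  moreover have "length (remdups_adj (?zs @ [x, y])) = length (remdups_adj ?zs) + 2"
    using assms Suc by (subst length_remdups_adj_append_pair) auto
  ultimately show ?case using Suc by simp
qed

text \<open>Prepending \<open>a\<close> does not change the number of runs for \<open>n > 0\<close>, and it makes the formula
  valid for \<open>n = 0\<close>.\<close>

lemma runs_alt_power:
  assumes "a < b" "a \<in> {1..c}" "b \<in> {1..c}" "\<And>i. i \<in> {1..n} \<Longrightarrow> e i > 0"
  defines "w \<equiv> \<lambda>n. a # filter (\<lambda>x. x \<in> {a, b}) (alt_power c e n)"
  shows "length (remdups_adj (w n)) = Suc (\<Sum>i=1..n. 2 * e i - 1) \<and>
    last (w n) = (if odd n then b else a)"
  using assms(4)
proof (induction n)
  case 0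
  then show ?case by (simp add: w_def alt_power_def)
next
  case (Suc n)
  \<comment> \<open>The orientations alternate, so the next restricted block begins with
    \<open>?x\<close>, the letter on which \<open>w n\<close> ends.\<close>
  let ?x = "if odd n then b else a" and ?y = "if odd n then a else b"
  obtain m where m: "e (Suc n) = Suc m"
    using Suc.prems [of "Suc n"] gr0_conv_Suc by auto
  have eq: "w (Suc n) = w n @ seq_power [?x, ?y] (Suc m)"
    using filter_two_block [OF assms(1-3), of "Suc n"]
    by (simp add: w_def alt_power_Suc filter_seq_power m)
  have IH: "length (remdups_adj (w n)) = Suc (\<Sum>i=1..n. 2 * e i - 1)" "last (w n) = ?x"
    using Suc by simp_all
  show ?case
    unfolding eq
    using runs_append_power [of "w n" ?x ?y m] IH assms(1) m by (simp add: w_def)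
qed

lemma alt_eq_alt_power: "alt c k = alt_power c (\<lambda>_. 1) k"
  by (simp add: alt_def alt_power_def seq_power_def)

lemma runs_alt_le:
  assumes "a \<noteq> b" "a \<in> {1..c}" "b \<in> {1..c}"
  shows "length (remdups_adj (filter (\<lambda>x. x \<in> {a, b}) (alt c k))) \<le> Suc k"
proof -
  \<comment> \<open>The run count assumes \<open>a < b\<close>. A renaming may reverse the order of
    letters, so the other order is covered by symmetry.\<close>
  have *: "length (remdups_adj (filter (\<lambda>x. x \<in> {a, b}) (alt c k))) \<le> Suc k"
    if "a < b" "a \<in> {1..c}" "b \<in> {1..c}" for a b
    using runs_alt_power [OF that, of k "\<lambda>_. 1"]
      length_remdups_adj_Cons_le [of "filter (\<lambda>x. x \<in> {a, b}) (alt c k)" a]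
    by (simp add: alt_eq_alt_power)
  show ?thesis
    using *[of a b] *[of b a] assms by (cases "a < b") (auto simp: insert_commute)
qed

section \<open>Embedding into \<open>alt\<close>\<close>

lemma alt_power_starts_with_block:
  assumes "n \<ge> 1" "e 1 > 0"
  shows "\<exists>zs. alt_power c e n = seq_I c @ zs"
proof -
  obtain m where "e 1 = Suc m"
    using assms gr0_conv_Suc by auto
  moreover have "[1..<Suc n] = 1 # [2..<Suc n]"
    using assms by (simp add: upt_rec numeral_2_eq_2)
  ultimately show ?thesis
    by (simp add: alt_power_def seq_power_def block_def)
qed

lemma set_alt_power_subset: "set (alt_power c e n) \<subseteq> {1..c}"
  by (auto simp: alt_power_def seq_power_def set_block)

text \<open>By parity, block \<open>k + 1\<close> of \<open>alt\<close> has the orientation of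
  \<open>block c i\<close>. Each further copy skips one block of the opposite orientation, hence
  costs two blocks.\<close>

lemma subseq_append_power_alt:
  assumes "subseq xs (alt c k)" "odd (Suc k) = odd i"
  shows "subseq (xs @ seq_power (block c i) (Suc m)) (alt c (k + (2 * m + 1)))"
proof (induction m)
  case 0
  have "block c (Suc k) = block c i"
    using assms(2) by (simp add: block_def)
  then show ?case
    using assms(1) by (simp add: alt_Suc seq_power_def)
next
  case (Suc m)
  let ?k = "k + (2 * m + 1)"
  have block: "block c (Suc (Suc ?k)) = block c i"
    using assms(2) by (simp add: block_def)
  have "subseq ((xs @ seq_power (block c i) (Suc m)) @ block c i) ((alt c ?k @ block c (Suc ?k)) @ block c i)"
    by (intro list_emb_append_mono [OF subseq_rev_drop_many [OF Suc]]) simp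
  moreover have "alt c (k + (2 * Suc m + 1)) = (alt c ?k @ block c (Suc ?k)) @ block c i"
    using alt_Suc [of c "Suc ?k"] alt_Suc [of c ?k] block by simp
  moreover have "xs @ seq_power (block c i) (Suc (Suc m)) = (xs @ seq_power (block c i) (Suc m)) @ block c i"
    by (simp add: seq_power_Suc)
  ultimately show ?case by (simp only:)
qed

text \<open>Each factor uses an odd number of blocks, so the parity claim makes the next block of
  \<open>alt\<close> match the next factor.\<close>

lemma subseq_alt_power_alt:
  assumes "\<And>i. i \<in> {1..n} \<Longrightarrow> e i > 0"
  shows "subseq (alt_power c e n) (alt c (\<Sum>i=1..n. 2 * e i - 1)) \<and>
    even (\<Sum>i=1..n. 2 * e i - 1) = even n"
  using assms
proof (induction n)
  case 0
  then show ?case by (simp add: alt_power_def)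
next
  case (Suc n)
  let ?k = "\<Sum>i=1..n. 2 * e i - 1"
  obtain m where m: "e (Suc n) = Suc m"
    using Suc.prems [of "Suc n"] gr0_conv_Suc by auto
  have IH: "subseq (alt_power c e n) (alt c ?k)" "even ?k = even n"
    using Suc by simp_all
  have "(\<Sum>i=1..Suc n. 2 * e i - 1) = ?k + (2 * m + 1)"
    using m by simp
  then show ?case
    using subseq_append_power_alt [OF IH(1), of "Suc n" m] IH(2) m
    by (simp only: alt_power_Suc) simp
qed

section \<open>Lower bound and exact value\<close>

lemma contains_alt_lower_bound:
  assumes "contains (alt c k) (alt_power c e n)" "c \<ge> 2" "n \<ge> 1" "\<And>i. i \<in> {1..n} \<Longrightarrow> e i > 0"
  shows "(\<Sum>i=1..n. 2 * e i - 1) \<le> k"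
proof -
  obtain t f where t: "subseq t (alt c k)" "inj_on f (set t)" "map f t = alt_power c e n"
    using assms(1) by (auto simp: contains_def)
  obtain zs where zs: "alt_power c e n = seq_I c @ zs"
    using alt_power_starts_with_block assms(3,4) by force
  have "{1, 2} \<subseteq> set (seq_I c)"
    using assms(2) by (auto simp: seq_I_def)
  then have "{1, 2} \<subseteq> f ` set t"
    using t(3) zs by (metis list.set_map set_append le_supI1)
  then obtain a b where ab: "a \<in> set t" "b \<in> set t" "f a = 1" "f b = 2"
    by auto
  have "set (alt c k) \<subseteq> {1..c}"
    using set_alt_power_subset by (simp only: alt_eq_alt_power)
  then have "set t \<subseteq> {1..c}"
    using t(1) by (blast elim: list_emb_set)
  then have ab': "a \<noteq> b" "a \<in> {1..c}" "b \<in> {1..c}"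
    using ab by auto
  let ?w = "filter (\<lambda>x. x \<in> {1, 2}) (alt_power c e n)"
  \<comment> \<open>Injectivity lets restriction to two letters commute with the renaming.\<close>
  have "f x \<in> {1, 2} \<longleftrightarrow> x \<in> {a, b}" if "x \<in> set t" for x
    using inj_on_eq_iff [OF t(2) that ab(1)] inj_on_eq_iff [OF t(2) that ab(2)] ab(3,4) by auto
  then have "filter (\<lambda>x. f x \<in> {1, 2}) t = filter (\<lambda>x. x \<in> {a, b}) t"
    by (intro filter_cong) auto
  then have w: "?w = map f (filter (\<lambda>x. x \<in> {a, b}) t)"
    unfolding t(3) [symmetric] filter_map comp_def by (rule arg_cong)
  have "seq_I c = block c 1"
    by (simp add: block_def)
  then have "?w = 1 # 2 # filter (\<lambda>x. x \<in> {1, 2}) zs"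
    using filter_two_block [of 1 2 c 1] assms(2) by (simp add: zs)
  \<comment> \<open>\<open>?w\<close> already begins with 1, so the letter prepended in
    \<open>runs_alt_power\<close> opens no new run.\<close>
  then have "length (remdups_adj ?w) = length (remdups_adj (1 # ?w))"
    by simp
  then have "Suc (\<Sum>i=1..n. 2 * e i - 1) = length (remdups_adj ?w)"
    using runs_alt_power [of 1 2 c n e] assms by simp
  also have "\<dots> = length (remdups_adj (filter (\<lambda>x. x \<in> {a, b}) t))"
    unfolding w using inj_on_subset [OF t(2)]
    by (subst remdups_adj_map_inj_on) auto
  also have "\<dots> \<le> length (remdups_adj (filter (\<lambda>x. x \<in> {a, b}) (alt c k)))"
    using t(1) by (intro subseq_length_remdups_adj_le subseq_filter)
  also have "\<dots> \<le> Suc k"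
    using ab' by (rule runs_alt_le)
  finally show ?thesis by simp
qed

theorem theorem3p5:
  fixes c n :: nat and e :: "nat \<Rightarrow> nat"
  assumes "c \<ge> 2" and "n \<ge> 1"
    and "\<And>i. i \<in> {1..n} \<Longrightarrow> e i > 0"
  shows "int (r (alt_power c e n)) = 2 * (\<Sum>i=1..n. int (e i)) - int n"
proof -
  let ?k = "\<Sum>i=1..n. 2 * e i - 1"
  \<comment> \<open>The initial \<open>seq_I c\<close> supplies all \<open>c\<close> letters, so
    \<open>r\<close> compares with \<open>alt c\<close>.\<close>
  obtain zs where "alt_power c e n = seq_I c @ zs"
    using alt_power_starts_with_block assms(2,3) by force
  then have "set (alt_power c e n) = {1..c}"
    using set_alt_power_subset [of c e n] by (auto simp: seq_I_def)
  then have card: "card (set (alt_power c e n)) = c"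
    by simp
  have "contains (alt c ?k) (alt_power c e n)"
    unfolding contains_def using subseq_alt_power_alt [OF assms(3)]
    by (intro exI [of _ "alt_power c e n"] exI [of _ id]) simp
  then have "r (alt_power c e n) = ?k"
    unfolding r_def card using contains_alt_lower_bound assms by (intro Least_equality) blast+
  \<comment> \<open>Positivity of \<open>e i\<close> keeps the natural subtraction from
    truncating.\<close>
  moreover have "int ?k = (\<Sum>i=1..n. 2 * int (e i) - 1)"
    unfolding of_nat_sum using assms(3) by (intro sum.cong) (auto simp: of_nat_diff Suc_le_eq)
  ultimately show ?thesis
    by (simp add: sum_subtractf sum_distrib_left)
qed

end
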